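(* Let $X$ be a graph and let $A$ and $B$ be subsets of $V(X)$. Let $X(A,B)$ be the graph with vertex set $V(X)\cup\{a_1,a_2,b_1,b_2\}$, where $a_1,a_2,b_1,b_2$ are four distinct vertices not in $V(X)$, and edge set $$E(X)\cup\{\{a_1,b_1\},\{a_2,b_2\}\}\cup\{\{a_1,a\},\{a_2,a\}\mid a\in A\}\cup\{\{b_1,b\},\{b_2,b\}\mid b\in B\}.$$ Then $X(A,B)$ is unstable. Moreover, if $X$ is connected, non-bipartite and twin-free, and at least one of $A$ and $B$ is non-empty, then $X(A,B)$ is non-trivially unstable.
   Context: All graphs are finite, simple and undirected. A graph is twin-free if distinct vertices have different neighbourhoods. The canonical double cover $BX$ of a graph $X$ is the direct product $X\times K_2$: $V(BX)=V(X)\times\{0,1\}$ and $E(BX)=\{\{(x,0),(y,1)\}\mid \{x,y\}\in E(X)\}$. Each $\varphi\in\operatorname{Aut}(X)$ lifts to the automorphism $(x,i)\mapsto(\varphi(x),i)$ of $BX$, and $\tau:(x,i)\mapsto(x,i+1)$ (second coordinate mod $2$) is also an automorphism of $BX$; the lifts and $\tau$ generate a subgroup of $\operatorname{Aut}(BX)$ isomorphic to $\operatorname{Aut}(X)\times S_2$. The graph $X$ is stable if $\operatorname{Aut}(BX)\cong\operatorname{Aut}(X)\times S_2$, equivalently if every automorphism of $BX$ belongs to this subgroup; otherwise $X$ is unstable. An unstable graph is non-trivially unstable if it is connected, non-bipartite and twin-free. *)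

theory Defs
  imports "Graph_Theory.Graph_Theory" "HOL-Algebra.Sym_Groups" "HOL-Algebra.Bij"
begin

text \<open>
  A finite simple undirected graph is a \<open>pair_graph\<close>: a finite vertex set with a symmetric
  irreflexive set of ordered pairs, the edge \<open>{x, y}\<close> being represented by the two pairs
  \<open>(x, y)\<close> and \<open>(y, x)\<close>. Connectedness is \<open>Digraph_Component.connected\<close>, for which the
  graph without vertices is not connected.
\<close>

definition neighbourhood :: "'a pair_pre_digraph \<Rightarrow> 'a \<Rightarrow> 'a set" where
  "neighbourhood X u = {v. (u, v) \<in> parcs X}"

definition twin_free :: "'a pair_pre_digraph \<Rightarrow> bool" where
  "twin_free X \<longleftrightarrow>
     (\<forall>u\<in>pverts X. \<forall>v\<in>pverts X. u \<noteq> v \<longrightarrow> neighbourhood X u \<noteq> neighbourhood X v)"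

definition bipartite :: "'a pair_pre_digraph \<Rightarrow> bool" where
  "bipartite X \<longleftrightarrow>
     (\<exists>U W. U \<union> W = pverts X \<and> U \<inter> W = {} \<and> parcs X \<subseteq> U \<times> W \<union> W \<times> U)"

definition direct_product ::
  "'a pair_pre_digraph \<Rightarrow> 'b pair_pre_digraph \<Rightarrow> ('a \<times> 'b) pair_pre_digraph" where
  "direct_product X Y =
     \<lparr> pverts = pverts X \<times> pverts Y,
       parcs = {((x, i), (y, j)) | x y i j. (x, y) \<in> parcs X \<and> (i, j) \<in> parcs Y} \<rparr>"

definition K2 :: "nat pair_pre_digraph" where
  "K2 = \<lparr> pverts = {0, 1}, parcs = {(0, 1), (1, 0)} \<rparr>"

definition double_cover :: "'a pair_pre_digraph \<Rightarrow> ('a \<times> nat) pair_pre_digraph" where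
  "double_cover X = direct_product X K2"

text \<open>
  As in \<open>BijGroup\<close>, permutations of the vertex set are taken to be \<open>undefined\<close> outside it, so
  that each automorphism is represented by exactly one function.
\<close>

definition graph_auts :: "'a pair_pre_digraph \<Rightarrow> ('a \<Rightarrow> 'a) set" where
  "graph_auts X =
     {f \<in> Bij (pverts X).
        \<forall>u\<in>pverts X. \<forall>v\<in>pverts X. (f u, f v) \<in> parcs X \<longleftrightarrow> (u, v) \<in> parcs X}"

definition Aut :: "'a pair_pre_digraph \<Rightarrow> ('a \<Rightarrow> 'a) monoid" where
  "Aut X = BijGroup (pverts X) \<lparr>carrier := graph_auts X\<rparr>"

text \<open>
  For graphs with at least one vertex this says that the lifts of automorphisms of \<open>X\<close> together
  with the exchange of the two layers generate the automorphism group of the double cover. (For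
  the graph without vertices the exchange of layers is the identity, and the two readings differ.)
\<close>

definition stable :: "'a pair_pre_digraph \<Rightarrow> bool" where
  "stable X \<longleftrightarrow> Aut (double_cover X) \<cong> Aut X \<times>\<times> sym_group 2"

abbreviation unstable :: "'a pair_pre_digraph \<Rightarrow> bool" where
  "unstable X \<equiv> \<not> stable X"

definition nontrivially_unstable :: "'a pair_pre_digraph \<Rightarrow> bool" where
  "nontrivially_unstable X \<longleftrightarrow>
     unstable X \<and> Digraph_Component.connected (with_proj X) \<and> \<not> bipartite X \<and> twin_free X"

definition extension ::
  "'a pair_pre_digraph \<Rightarrow> 'a set \<Rightarrow> 'a set \<Rightarrow> 'a \<Rightarrow> 'a \<Rightarrow> 'a \<Rightarrow> 'a \<Rightarrow> 'a pair_pre_digraph" where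
  "extension X A B a1 a2 b1 b2 =
     (let N = {(a1, b1), (a2, b2)} \<union> {(a1, a) | a. a \<in> A} \<union> {(a2, a) | a. a \<in> A}
                \<union> {(b1, b) | b. b \<in> B} \<union> {(b2, b) | b. b \<in> B}
      in \<lparr> pverts = pverts X \<union> {a1, a2, b1, b2}, parcs = parcs X \<union> N \<union> N\<inverse> \<rparr>)"

lemma pair_graph_iff:
  "pair_graph X \<longleftrightarrow>
     finite (pverts X) \<and> parcs X \<subseteq> pverts X \<times> pverts X \<and> sym (parcs X) \<and> irrefl (parcs X)"
proof
  assume "pair_graph X"
  then interpret pair_graph X .
  show "finite (pverts X) \<and> parcs X \<subseteq> pverts X \<times> pverts X \<and> sym (parcs X) \<and> irrefl (parcs X)"
    using pair_finite_verts in_arcsD1 in_arcsD2 arcs_symmetric no_loops'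
    by (force simp: sym_def irrefl_def)
next
  assume *: "finite (pverts X) \<and> parcs X \<subseteq> pverts X \<times> pverts X \<and> sym (parcs X) \<and> irrefl (parcs X)"
  then have "finite (parcs X)"
    by (meson finite_SigmaI finite_subset)
  with * show "pair_graph X"
    by unfold_locales (auto simp: symmetric_def irrefl_def)
qed

lemma pair_graph_double_cover:
  assumes "pair_graph X"
  shows "pair_graph (double_cover X)"
  using assms
  by (auto simp: pair_graph_iff double_cover_def direct_product_def K2_def sym_def irrefl_def)

lemma parcs_double_cover:
  assumes "pair_graph X"
  shows "parcs (double_cover X) =
    (let E = {((x, 0), (y, 1)) | x y. (x, y) \<in> parcs X} in E \<union> E\<inverse>)"
  using assms
  by (auto simp: pair_graph_iff double_cover_def direct_product_def K2_def sym_def Let_def)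

lemma pair_graph_extension:
  assumes "pair_graph X" "A \<subseteq> pverts X" "B \<subseteq> pverts X"
    and "distinct [a1, a2, b1, b2]" "{a1, a2, b1, b2} \<inter> pverts X = {}"
  shows "pair_graph (extension X A B a1 a2 b1 b2)"
proof -
  define N where "N = {(a1, b1), (a2, b2)} \<union> {(a1, a) | a. a \<in> A} \<union> {(a2, a) | a. a \<in> A}
    \<union> {(b1, b) | b. b \<in> B} \<union> {(b2, b) | b. b \<in> B}"
  have X: "finite (pverts X)" "parcs X \<subseteq> pverts X \<times> pverts X" "sym (parcs X)" "irrefl (parcs X)"
    using assms(1) by (simp_all add: pair_graph_iff)
  have ext: "extension X A B a1 a2 b1 b2 =
      \<lparr> pverts = pverts X \<union> {a1, a2, b1, b2}, parcs = parcs X \<union> N \<union> N\<inverse> \<rparr>"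
    by (simp add: extension_def N_def Let_def)
  have N: "N \<subseteq> (pverts X \<union> {a1, a2, b1, b2}) \<times> (pverts X \<union> {a1, a2, b1, b2})"
    using assms(2,3) unfolding N_def by blast
  have "irrefl N"
    using assms(2-5) unfolding N_def irrefl_def by auto
  then have irr: "irrefl (parcs X \<union> N \<union> N\<inverse>)"
    using X(4) by (simp add: irrefl_def)
  have "sym (parcs X \<union> N \<union> N\<inverse>)"
    using X(3) by (simp add: sym_def)
  moreover have "parcs X \<union> N \<union> N\<inverse> \<subseteq>
      (pverts X \<union> {a1, a2, b1, b2}) \<times> (pverts X \<union> {a1, a2, b1, b2})"
    using X(2) N by blast
  moreover have "finite (pverts X \<union> {a1, a2, b1, b2})"
    using X(1) by simp
  ultimately show ?thesis
    unfolding pair_graph_iff ext pair_pre_digraph.simps using irr by blast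
qed

lemma subgroup_graph_auts: "subgroup (graph_auts X) (BijGroup (pverts X))"
proof (rule group.subgroupI[OF group_BijGroup])
  show "graph_auts X \<subseteq> carrier (BijGroup (pverts X))"
    by (auto simp: graph_auts_def BijGroup_def)
  show "graph_auts X \<noteq> {}"
    using id_Bij by (fastforce simp: graph_auts_def)
next
  fix f assume f: "f \<in> graph_auts X"
  then have b: "f \<in> Bij (pverts X)" by (simp add: graph_auts_def)
  have "f (inv_into (pverts X) f u) = u" if "u \<in> pverts X" for u
    using b that by (simp add: Bij_def bij_betw_def f_inv_into_f)
  then show "inv\<^bsub>BijGroup (pverts X)\<^esub> f \<in> graph_auts X"
    using f Bij_inv_into_mem[OF b] restrict_inv_into_Bij[OF b]
    unfolding inv_BijGroup[OF b] graph_auts_def by (smt (verit) mem_Collect_eq restrict_apply')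
next
  fix f g assume fg: "f \<in> graph_auts X" "g \<in> graph_auts X"
  then have b: "f \<in> Bij (pverts X)" "g \<in> Bij (pverts X)" by (simp_all add: graph_auts_def)
  have "g u \<in> pverts X" if "u \<in> pverts X" for u
    using Bij_imp_funcset[OF b(2)] that by blast
  then show "f \<otimes>\<^bsub>BijGroup (pverts X)\<^esub> g \<in> graph_auts X"
    using fg b by (simp add: graph_auts_def BijGroup_def compose_Bij compose_eq)
qed

lemma group_Aut: "group (Aut X)"
  unfolding Aut_def by (intro subgroup.subgroup_is_group subgroup_graph_auts group_BijGroup)

end

theory Submission
  imports Defs
begin

text \<open>
  For permutations \<open>\<alpha>\<close>, \<open>\<beta>\<close> of the vertices such that \<open>(\<alpha> x, \<beta> y)\<close> is an arc exactly when
  \<open>(x, y)\<close> is, applying \<open>\<alpha>\<close> on layer \<open>0\<close> and \<open>\<beta>\<close> on layer \<open>1\<close> is an automorphism of the double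
  cover. If \<open>\<alpha> \<noteq> \<beta>\<close>, it is neither a lift nor a lift composed with the exchange of the layers,
  so the finite group \<open>Aut(BX)\<close> has more than \<open>2 |Aut(X)|\<close> elements. For \<open>X(A,B)\<close> take
  \<open>\<alpha> = (a\<^sub>1 a\<^sub>2)\<close> and \<open>\<beta> = (b\<^sub>1 b\<^sub>2)\<close>: the neighbourhoods of \<open>a\<^sub>1\<close> and \<open>a\<^sub>2\<close> differ only in
  \<open>b\<^sub>1, b\<^sub>2\<close>, and those of \<open>b\<^sub>1\<close> and \<open>b\<^sub>2\<close> only in \<open>a\<^sub>1, a\<^sub>2\<close>.
\<close>

section \<open>Arcs and automorphisms of the double cover\<close>

lemma pverts_double_cover: "pverts (double_cover X) = pverts X \<times> {0, 1}"
  by (simp add: double_cover_def direct_product_def K2_def)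

lemma arc_double_cover_iff:
  "((x, i), (y, j)) \<in> parcs (double_cover X) \<longleftrightarrow>
     (x, y) \<in> parcs X \<and> (i = 0 \<and> j = 1 \<or> i = 1 \<and> j = 0)"
  by (auto simp: double_cover_def direct_product_def K2_def)

lemma finite_graph_auts:
  assumes "finite (pverts X)"
  shows "finite (graph_auts X)"
proof -
  have "graph_auts X \<subseteq> pverts X \<rightarrow>\<^sub>E pverts X"
    by (auto simp: graph_auts_def PiE_def Bij_def bij_betw_def)
  with assms show ?thesis
    by (meson finite_PiE finite_subset)
qed

lemma graph_autsI:
  assumes "bij_betw g (pverts X) (pverts X)"
    and "\<And>u v. u \<in> pverts X \<Longrightarrow> v \<in> pverts X \<Longrightarrow> (g u, g v) \<in> parcs X \<longleftrightarrow> (u, v) \<in> parcs X"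
  shows "restrict g (pverts X) \<in> graph_auts X"
  using assms by (simp add: graph_auts_def Bij_def)

lemma graph_autsD:
  assumes "f \<in> graph_auts X"
  shows "bij_betw f (pverts X) (pverts X)" "f \<in> extensional (pverts X)"
    and "\<And>u v. u \<in> pverts X \<Longrightarrow> v \<in> pverts X \<Longrightarrow> (f u, f v) \<in> parcs X \<longleftrightarrow> (u, v) \<in> parcs X"
  using assms by (auto simp: graph_auts_def Bij_def)

definition layer_map :: "('a \<Rightarrow> 'a) \<Rightarrow> ('a \<Rightarrow> 'a) \<Rightarrow> 'a \<times> nat \<Rightarrow> 'a \<times> nat" where
  "layer_map \<alpha> \<beta> = (\<lambda>(x, i). (if i = 0 then \<alpha> x else \<beta> x, i))"

text \<open>This is the map tau. Subtraction on \<open>nat\<close> is truncated, so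
  \<open>1 - i\<close> is an exchange only on the layers 0 and 1; all uses are confined to
  these.\<close>

definition layer_swap :: "'a \<times> nat \<Rightarrow> 'a \<times> nat" where
  "layer_swap = (\<lambda>(x, i). (x, 1 - i))"

lemma bij_betw_layer_map:
  assumes "bij_betw \<alpha> V V" "bij_betw \<beta> V V"
  shows "bij_betw (layer_map \<alpha> \<beta>) (V \<times> {0, 1}) (V \<times> {0, 1})"
proof (rule bij_betw_imageI)
  show "inj_on (layer_map \<alpha> \<beta>) (V \<times> {0, 1})"
    using assms by (auto simp: inj_on_def layer_map_def bij_betw_def split: if_splits)
  have "layer_map \<alpha> \<beta> ` (V \<times> {0, 1}) = \<alpha> ` V \<times> {0} \<union> \<beta> ` V \<times> {1}"
    by (force simp: layer_map_def)
  then show "layer_map \<alpha> \<beta> ` (V \<times> {0, 1}) = V \<times> {0, 1}"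
    using assms by (auto simp: bij_betw_def)
qed

text \<open>The hypothesis covers arcs from layer 0 to layer 1. Arcs in the other direction need the
  same for \<open>(\<beta> x, \<alpha> y)\<close>, which follows from the symmetry of
  \<open>parcs X\<close>.\<close>

lemma layer_map_in_graph_auts:
  assumes "pair_graph X"
    and "bij_betw \<alpha> (pverts X) (pverts X)" "bij_betw \<beta> (pverts X) (pverts X)"
    and "\<And>x y. x \<in> pverts X \<Longrightarrow> y \<in> pverts X \<Longrightarrow> (\<alpha> x, \<beta> y) \<in> parcs X \<longleftrightarrow> (x, y) \<in> parcs X"
  shows "restrict (layer_map \<alpha> \<beta>) (pverts X \<times> {0, 1}) \<in> graph_auts (double_cover X)"
proof -
  have "sym (parcs X)"
    using assms(1) by (simp add: pair_graph_iff)
  with assms(4) have "(\<beta> x, \<alpha> y) \<in> parcs X \<longleftrightarrow> (x, y) \<in> parcs X"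
    if "x \<in> pverts X" "y \<in> pverts X" for x y
    using that by (meson symD)
  with assms(4) bij_betw_layer_map[OF assms(2,3)]
  have "restrict (layer_map \<alpha> \<beta>) (pverts (double_cover X)) \<in> graph_auts (double_cover X)"
    by (intro graph_autsI, unfold pverts_double_cover)
       (assumption, auto simp: layer_map_def arc_double_cover_iff)
  then show ?thesis
    by (simp add: pverts_double_cover)
qed

lemma layer_swap_layer_map_in_graph_auts:
  assumes "\<phi> \<in> graph_auts X"
  shows "restrict (layer_swap \<circ> layer_map \<phi> \<phi>) (pverts X \<times> {0, 1}) \<in> graph_auts (double_cover X)"
proof -
  have "bij_betw layer_swap (pverts X \<times> {0, 1}) (pverts X \<times> {0, 1})"
    by (rule bij_betw_byWitness[where f' = layer_swap]) (auto simp: layer_swap_def)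
  then have "bij_betw (layer_swap \<circ> layer_map \<phi> \<phi>) (pverts X \<times> {0, 1}) (pverts X \<times> {0, 1})"
    using bij_betw_layer_map bij_betw_trans graph_autsD(1)[OF assms] by blast
  then have "restrict (layer_swap \<circ> layer_map \<phi> \<phi>) (pverts (double_cover X))
      \<in> graph_auts (double_cover X)"
    using graph_autsD(3)[OF assms]
    by (intro graph_autsI, unfold pverts_double_cover)
       (auto simp: layer_map_def layer_swap_def arc_double_cover_iff)
  then show ?thesis
    by (simp add: pverts_double_cover)
qed

section \<open>Instability by counting automorphisms\<close>

text \<open>Stability is an abstract isomorphism and says nothing about individual automorphisms, so
  the contradiction comes from cardinalities: the lifts, with and without exchange of layers,
  already fill the available number, and \<open>f\<close> is one more because each of them gives
  \<open>(x, 0)\<close> and \<open>(x, 1)\<close> the same first coordinate.\<close>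

lemma unstable_if_not_lift:
  assumes X: "pair_graph X"
    and f: "f \<in> graph_auts (double_cover X)"
    and x: "x \<in> pverts X" "fst (f (x, 0)) \<noteq> fst (f (x, 1))"
  shows "unstable X"
proof
  assume "stable X"
  then obtain h where "h \<in> iso (Aut (double_cover X)) (Aut X \<times>\<times> sym_group 2)"
    by (auto simp: stable_def is_iso_def)
  then have "bij_betw h (graph_auts (double_cover X)) (graph_auts X \<times> {p. p permutes {1..2}})"
    by (simp add: iso_def Aut_def DirProd_def sym_group_def)
  then have "card (graph_auts (double_cover X)) = card (graph_auts X \<times> {p. p permutes {1..2::nat}})"
    by (rule bij_betw_same_card)
  also have "\<dots> = 2 * card (graph_auts X)"
    by (simp add: card_cartesian_product card_permutations)
  finally have card_cover: "card (graph_auts (double_cover X)) = 2 * card (graph_auts X)" .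

  define S where "S = pverts X \<times> {0::nat, 1}"
  \<comment> \<open>The flag \<open>b\<close> plays the part of S_2: it tells whether the layers are
    exchanged. The restriction makes the map extensional, as members of \<open>graph_auts\<close>
    must be.\<close>
  define lift where "lift = (\<lambda>(\<phi>, b).
    restrict (if b then layer_swap \<circ> layer_map \<phi> \<phi> else layer_map \<phi> \<phi>) S)"
  have lift_0: "lift (\<phi>, b) (y, 0) = (\<phi> y, if b then 1 else 0)"
    and lift_1: "lift (\<phi>, b) (y, 1) = (\<phi> y, if b then 0 else 1)" if "y \<in> pverts X" for \<phi> b y
    using that by (auto simp: lift_def S_def layer_map_def layer_swap_def)
  have lifts: "lift ` (graph_auts X \<times> UNIV) \<subseteq> graph_auts (double_cover X)"
    using layer_map_in_graph_auts[OF X] layer_swap_layer_map_in_graph_auts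
    by (auto simp: lift_def S_def graph_autsD)
  have "inj_on lift (graph_auts X \<times> UNIV)"
  proof (rule inj_onI, clarify, intro conjI)
    fix \<phi> \<psi> b c
    assume \<phi>: "\<phi> \<in> graph_auts X" and \<psi>: "\<psi> \<in> graph_auts X" and eq: "lift (\<phi>, b) = lift (\<psi>, c)"
    have "\<phi> y = \<psi> y" if "y \<in> pverts X" for y
      using lift_0[OF that, of \<phi> b] lift_0[OF that, of \<psi> c] eq by simp
    with graph_autsD(2)[OF \<phi>] graph_autsD(2)[OF \<psi>] show "\<phi> = \<psi>"
      by (rule extensionalityI)
    \<comment> \<open>The layer of the image of \<open>(x, 0)\<close> reveals the flag; this is
      where a vertex must exist.\<close>
    show "b = c"
      using arg_cong[OF eq, of "\<lambda>g. snd (g (x, 0))"]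
      by (cases b; cases c) (simp_all only: lift_0[OF x(1)] snd_conv, simp_all)
  qed
  then have card_lifts: "card (lift ` (graph_auts X \<times> UNIV)) = 2 * card (graph_auts X)"
    by (simp add: card_image card_cartesian_product)
  have "f \<notin> lift ` (graph_auts X \<times> UNIV)"
    using lift_0[OF x(1)] lift_1[OF x(1)] x(2) by auto
  with f lifts have "lift ` (graph_auts X \<times> UNIV) \<subset> graph_auts (double_cover X)"
    by blast
  moreover have "finite (graph_auts (double_cover X))"
    using X by (intro finite_graph_auts) (simp add: pverts_double_cover pair_graph_iff)
  ultimately have "card (lift ` (graph_auts X \<times> UNIV)) < card (graph_auts (double_cover X))"
    by (simp add: psubset_card_mono)
  with card_cover card_lifts show False
    by simp
qed

text \<open>The pair \<open>(\<alpha>, \<beta>)\<close> is known as a two-fold automorphism;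
  \<open>x\<close> witnesses that it is non-trivial.\<close>

lemma unstable_if_two_fold:
  assumes "pair_graph X"
    and "bij_betw \<alpha> (pverts X) (pverts X)" "bij_betw \<beta> (pverts X) (pverts X)"
    and "\<And>x y. x \<in> pverts X \<Longrightarrow> y \<in> pverts X \<Longrightarrow> (\<alpha> x, \<beta> y) \<in> parcs X \<longleftrightarrow> (x, y) \<in> parcs X"
    and "x \<in> pverts X" "\<alpha> x \<noteq> \<beta> x"
  shows "unstable X"
proof (rule unstable_if_not_lift)
  show "pair_graph X" "x \<in> pverts X"
    by fact+
  show "restrict (layer_map \<alpha> \<beta>) (pverts X \<times> {0, 1}) \<in> graph_auts (double_cover X)"
    using assms(1-4) by (rule layer_map_in_graph_auts)
  show "fst (restrict (layer_map \<alpha> \<beta>) (pverts X \<times> {0, 1}) (x, 0)) \<noteq>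
      fst (restrict (layer_map \<alpha> \<beta>) (pverts X \<times> {0, 1}) (x, 1))"
    using assms(5,6) by (simp add: layer_map_def)
qed

section \<open>Connectedness, arcs and neighbourhoods of X(A,B)\<close>

text \<open>Symmetric arcs equal their symmetric closure, and walks that start at a vertex never
  leave the vertex set.\<close>

lemma connected_iff_rtrancl:
  assumes "pair_graph X"
  shows "Digraph_Component.connected (with_proj X) \<longleftrightarrow>
    pverts X \<noteq> {} \<and> (\<forall>u\<in>pverts X. \<forall>v\<in>pverts X. (u, v) \<in> (parcs X)\<^sup>*)"
proof -
  interpret pair_graph X
    by fact
  have "(u, v) \<in> rtrancl_on (pverts X) (parcs X) \<longleftrightarrow> (u, v) \<in> (parcs X)\<^sup>*"
    if "u \<in> pverts X" for u v
    using reachable_conv'[of u v] that by (simp add: reachable_def)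
  moreover have "(parcs X)\<^sup>s = parcs X"
    using assms by (auto simp: pair_graph_iff symcl_def sym_def)
  ultimately show ?thesis
    by (simp add: connected_conv)
qed

lemma pverts_extension:
  "pverts (extension X A B a1 a2 b1 b2) = pverts X \<union> {a1, a2, b1, b2}"
  by (simp add: extension_def Let_def)

lemma arc_extension_iff:
  "(x, y) \<in> parcs (extension X A B a1 a2 b1 b2) \<longleftrightarrow>
     (x, y) \<in> parcs X
     \<or> x = a1 \<and> y = b1 \<or> x = a2 \<and> y = b2 \<or> x = b1 \<and> y = a1 \<or> x = b2 \<and> y = a2
     \<or> x \<in> {a1, a2} \<and> y \<in> A \<or> x \<in> A \<and> y \<in> {a1, a2}
     \<or> x \<in> {b1, b2} \<and> y \<in> B \<or> x \<in> B \<and> y \<in> {b1, b2}"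
  by (auto simp: extension_def Let_def)

context
  fixes X :: "'a pair_pre_digraph" and A B :: "'a set" and a1 a2 b1 b2 :: 'a
  assumes X: "pair_graph X"
    and AB: "A \<subseteq> pverts X" "B \<subseteq> pverts X"
    and new: "distinct [a1, a2, b1, b2]" "{a1, a2, b1, b2} \<inter> pverts X = {}"
begin

lemma arcs_in_pverts: "(x, y) \<in> parcs X \<Longrightarrow> x \<in> pverts X \<and> y \<in> pverts X"
  using X by (auto simp: pair_graph_iff)

text \<open>The first swap acts on tails only, the second on heads only. Hence
  \<open>(a1, b1)\<close> and \<open>(a2, b2)\<close> are interchanged, while
  \<open>(b1, a1)\<close> and \<open>(b2, a2)\<close> are fixed. The other new arcs survive since
  \<open>a1\<close>, \<open>a2\<close> are both joined to all of \<open>A\<close>, and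
  \<open>b1\<close>, \<open>b2\<close> to all of \<open>B\<close>.\<close>

lemma arc_extension_transpose:
  assumes "(x, y) \<in> parcs (extension X A B a1 a2 b1 b2)"
  shows "(transpose a1 a2 x, transpose b1 b2 y) \<in> parcs (extension X A B a1 a2 b1 b2)"
  using assms AB new arcs_in_pverts[of x y]
  unfolding arc_extension_iff transpose_def by auto

lemma unstable_extension: "unstable (extension X A B a1 a2 b1 b2)"
proof (rule unstable_if_two_fold)
  let ?E = "extension X A B a1 a2 b1 b2"
  show "pair_graph ?E"
    using X AB new by (rule pair_graph_extension)
  show "bij_betw (transpose a1 a2) (pverts ?E) (pverts ?E)"
    "bij_betw (transpose b1 b2) (pverts ?E) (pverts ?E)"
    by (simp_all add: pverts_extension permutes_imp_bij permutes_swap_id)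
  \<comment> \<open>Transpositions are involutions, so applying the one-way lemma to the image gives
    the converse.\<close>
  show "(transpose a1 a2 x, transpose b1 b2 y) \<in> parcs ?E \<longleftrightarrow> (x, y) \<in> parcs ?E" for x y
    using arc_extension_transpose[of x y]
      arc_extension_transpose[of "transpose a1 a2 x" "transpose b1 b2 y"] by auto
  show "a1 \<in> pverts ?E"
    by (simp add: pverts_extension)
  show "transpose a1 a2 a1 \<noteq> transpose b1 b2 a1"
    using new by auto
qed

text \<open>A vertex \<open>c\<close> of \<open>A\<close> or \<open>B\<close> serves as a hub: old
  vertices reach it inside \<open>X\<close>, new ones directly or through their partner in
  \<open>a1 b1\<close> or \<open>a2 b2\<close>. Symmetry then joins any two vertices.\<close>

lemma connected_extension:
  assumes "Digraph_Component.connected (with_proj X)" "A \<noteq> {} \<or> B \<noteq> {}"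
  shows "Digraph_Component.connected (with_proj (extension X A B a1 a2 b1 b2))"
proof -
  let ?E = "extension X A B a1 a2 b1 b2"
  have E: "pair_graph ?E"
    using X AB new by (rule pair_graph_extension)
  have "sym ((parcs ?E)\<^sup>*)"
    using E by (simp add: pair_graph_iff sym_rtrancl)
  then have flip: "(u, v) \<in> (parcs ?E)\<^sup>*" if "(v, u) \<in> (parcs ?E)\<^sup>*" for u v
    using that by (rule symD)
  have "parcs X \<subseteq> parcs ?E"
    by (auto simp: arc_extension_iff)
  then have inner: "(u, v) \<in> (parcs ?E)\<^sup>*" if "u \<in> pverts X" "v \<in> pverts X" for u v
    using assms(1) that rtrancl_mono unfolding connected_iff_rtrancl[OF X] by blast
  have ab: "(a1, b1) \<in> (parcs ?E)\<^sup>*" "(a2, b2) \<in> (parcs ?E)\<^sup>*"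
    by (auto simp: arc_extension_iff)
  from assms(2) consider c where "c \<in> A" | c where "c \<in> B"
    by blast
  then have "\<exists>c\<in>pverts X. \<forall>u\<in>{a1, a2, b1, b2}. (u, c) \<in> (parcs ?E)\<^sup>*"
  proof cases
    case (1 c)
    then have "(a1, c) \<in> (parcs ?E)\<^sup>*" "(a2, c) \<in> (parcs ?E)\<^sup>*"
      by (auto simp: arc_extension_iff)
    with 1 AB(1) ab[THEN flip] show ?thesis
      by (auto intro!: bexI[of _ c] intro: rtrancl_trans)
  next
    case (2 c)
    then have "(b1, c) \<in> (parcs ?E)\<^sup>*" "(b2, c) \<in> (parcs ?E)\<^sup>*"
      by (auto simp: arc_extension_iff)
    with 2 AB(2) ab show ?thesis
      by (auto intro!: bexI[of _ c] intro: rtrancl_trans)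
  qed
  then obtain c where c: "c \<in> pverts X"
    and reach: "\<And>u. u \<in> {a1, a2, b1, b2} \<Longrightarrow> (u, c) \<in> (parcs ?E)\<^sup>*"
    by blast
  have to_c: "(u, c) \<in> (parcs ?E)\<^sup>*" if "u \<in> pverts ?E" for u
    using that inner[OF _ c] reach by (auto simp: pverts_extension)
  then have "(u, v) \<in> (parcs ?E)\<^sup>*" if "u \<in> pverts ?E" "v \<in> pverts ?E" for u v
    using that flip rtrancl_trans by metis
  then show ?thesis
    unfolding connected_iff_rtrancl[OF E] by (auto simp: pverts_extension)
qed

text \<open>A bipartition restricts to the subgraph \<open>X\<close>.\<close>

lemma not_bipartite_extension:
  assumes "\<not> bipartite X"
  shows "\<not> bipartite (extension X A B a1 a2 b1 b2)"
proof
  let ?E = "extension X A B a1 a2 b1 b2"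
  assume "bipartite ?E"
  then obtain U W where UW: "U \<union> W = pverts ?E" "U \<inter> W = {}" "parcs ?E \<subseteq> U \<times> W \<union> W \<times> U"
    by (auto simp: bipartite_def)
  have "parcs X \<subseteq> parcs ?E"
    by (auto simp: arc_extension_iff)
  with UW(3) arcs_in_pverts
  have "parcs X \<subseteq> (U \<inter> pverts X) \<times> (W \<inter> pverts X) \<union> (W \<inter> pverts X) \<times> (U \<inter> pverts X)"
    by blast
  moreover have "(U \<inter> pverts X) \<union> (W \<inter> pverts X) = pverts X"
    using UW(1) by (auto simp: pverts_extension)
  ultimately have "bipartite X"
    using UW(2) unfolding bipartite_def by blast
  with assms show False
    by contradiction
qed

text \<open>Intersecting with \<open>pverts X\<close> recovers the old neighbourhood of an old
  vertex, and each new vertex is identified by its neighbourhood alone.\<close>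

lemma twin_free_extension:
  assumes "twin_free X"
  shows "twin_free (extension X A B a1 a2 b1 b2)"
  unfolding twin_free_def
proof (intro ballI impI)
  let ?E = "extension X A B a1 a2 b1 b2"
  fix u v assume uv: "u \<in> pverts ?E" "v \<in> pverts ?E" "u \<noteq> v"
  have N: "neighbourhood ?E w = neighbourhood X w
      \<union> (if w \<in> A then {a1, a2} else {}) \<union> (if w \<in> B then {b1, b2} else {})"
    if "w \<in> pverts X" for w
    using that AB new unfolding neighbourhood_def arc_extension_iff by auto
  have NX: "neighbourhood X w \<subseteq> pverts X" for w
    using arcs_in_pverts by (auto simp: neighbourhood_def)
  show "neighbourhood ?E u \<noteq> neighbourhood ?E v"
  proof (cases "u \<in> pverts X \<and> v \<in> pverts X")
    case True
    then have "neighbourhood X w = neighbourhood ?E w \<inter> pverts X" if "w = u \<or> w = v" for w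
      using that N NX[of w] new(2) by (auto split: if_splits)
    with True uv(3) assms show ?thesis
      by (metis twin_free_def)
  next
    case False
    have arcs_new: "(w, z) \<notin> parcs X" "z \<notin> A" "z \<notin> B" if "z \<in> {a1, a2, b1, b2}" for w z
      using that AB new(2) arcs_in_pverts by blast+
    have "b1 \<in> neighbourhood ?E w \<longleftrightarrow> w = a1 \<or> w \<in> B" "b2 \<in> neighbourhood ?E w \<longleftrightarrow> w = a2 \<or> w \<in> B"
      "a1 \<in> neighbourhood ?E w \<longleftrightarrow> w = b1 \<or> w \<in> A" "a2 \<in> neighbourhood ?E w \<longleftrightarrow> w = b2 \<or> w \<in> A" for w
      using new(1) arcs_new by (auto simp: neighbourhood_def arc_extension_iff)
    \<comment> \<open>Vertices of \<open>B\<close> see both \<open>b1\<close> and \<open>b2\<close>,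
      so seeing exactly one of them singles out \<open>a1\<close> or \<open>a2\<close>; likewise
      with \<open>A\<close> for \<open>b1\<close> and \<open>b2\<close>.\<close>
    then have sep: "w = a1 \<longleftrightarrow> b1 \<in> neighbourhood ?E w \<and> b2 \<notin> neighbourhood ?E w"
      "w = a2 \<longleftrightarrow> b2 \<in> neighbourhood ?E w \<and> b1 \<notin> neighbourhood ?E w"
      "w = b1 \<longleftrightarrow> a1 \<in> neighbourhood ?E w \<and> a2 \<notin> neighbourhood ?E w"
      "w = b2 \<longleftrightarrow> a2 \<in> neighbourhood ?E w \<and> a1 \<notin> neighbourhood ?E w" for w
      using new(1) arcs_new by auto
    show ?thesis
    proof
      assume eq: "neighbourhood ?E u = neighbourhood ?E v"
      \<comment> \<open>Under \<open>eq\<close> the criteria in \<open>sep\<close> for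
        \<open>u\<close> and for \<open>v\<close> coincide.\<close>
      then have "u = z \<longleftrightarrow> v = z" if "z \<in> {a1, a2, b1, b2}" for z
        using that sep[of u, unfolded eq, folded sep[of v]] by blast
      with False uv show False
        by (auto simp: pverts_extension)
    qed
  qed
qed

end

theorem proposition5p2:
  fixes X :: "'a pair_pre_digraph" and A B :: "'a set" and a1 a2 b1 b2 :: 'a
  assumes "pair_graph X"
    and "A \<subseteq> pverts X" and "B \<subseteq> pverts X"
    and "distinct [a1, a2, b1, b2]" and "{a1, a2, b1, b2} \<inter> pverts X = {}"
  shows "unstable (extension X A B a1 a2 b1 b2) \<and>
    (Digraph_Component.connected (with_proj X) \<and> \<not> bipartite X \<and> twin_free X \<and>
       (A \<noteq> {} \<or> B \<noteq> {})
     \<longrightarrow> nontrivially_unstable (extension X A B a1 a2 b1 b2))"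
  unfolding nontrivially_unstable_def
  using unstable_extension[OF assms] connected_extension[OF assms]
    not_bipartite_extension[OF assms] twin_free_extension[OF assms]
  by blast

end
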